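(* Let $A\in\mathbb{R}^{k_1\times k_2}$, $b_1\in\mathbb{R}^{k_1}$, $b_2\in\mathbb{R}^{k_2}$, and suppose the unconstrained bilinear zero-sum game defined by $(A,b_1,b_2)$ admits a Nash equilibrium $x^\star$. Let $\eta>0$, let $\{x^t\}_{t\ge0}$ be generated by Implicit Midpoint Gradient Descent (IMGD) with learning rate $\eta$ from an arbitrary $x^0\in\mathbb{R}^{k_1+k_2}$, and for each integer $T\ge 1$ let $\bar x^T:=\frac1T\sum_{t=0}^{T-1}x^t$. Then for all $T\ge 1$, $$\lVert G\bar x^T+c\rVert\le\frac{\lVert x^0-x^\star\rVert}{T}\left(\frac{2}{\eta}+\lVert G\rVert\right).$$ In particular, $\lVert G\bar x^T+c\rVert\in O\!\left(\frac{1}{\eta T}+\frac1T\right)$.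
   Context: The game: player 1 chooses $x_1\in\mathbb{R}^{k_1}$ and player 2 chooses $x_2\in\mathbb{R}^{k_2}$, with utilities $u_1(x_1,x_2)=x_1^\top A x_2+b_1^\top x_1-b_2^\top x_2$ and $u_2=-u_1$. A pair $x^\star=(x_1^\star,x_2^\star)$ is a Nash equilibrium if $u_1(x_1,x_2^\star)\le u_1(x_1^\star,x_2^\star)\le u_1(x_1^\star,x_2)$ for all $x_1\in\mathbb{R}^{k_1}$, $x_2\in\mathbb{R}^{k_2}$; equivalently $Gx^\star+c=0$, where $$G=\begin{pmatrix} 0 & A \\ -A^\top & 0 \end{pmatrix},\qquad c=\begin{pmatrix} b_1 \\ b_2 \end{pmatrix}.$$ Stack $x=(x_1,x_2)\in\mathbb{R}^{k_1+k_2}$. IMGD with learning rate $\eta>0$ is the iteration $$x^{t+1}=x^t+\tfrac{\eta}{2}\bigl((Gx^{t+1}+c)+(Gx^t+c)\bigr),$$ i.e. $x^{t+1}=(I-\tfrac{\eta}{2}G)^{-1}\bigl((I+\tfrac{\eta}{2}G)x^t+\eta c\bigr)$ (the inverse exists for every $\eta>0$). $\lVert\cdot\rVert$ is the Euclidean norm for vectors and the induced operator (spectral) norm for matrices. *)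

theory Defs
  imports "HOL-Analysis.Analysis" "HOL-Library.Landau_Symbols"
begin

text \<open>
  The strategy spaces are \<open>real ^ 'm\<close> and \<open>real ^ 'n\<close>; the stacked space of dimension
  \<open>CARD('m) + CARD('n)\<close> is indexed by the sum type \<open>'m + 'n\<close>.
\<close>

definition stack :: "real ^ 'm \<Rightarrow> real ^ 'n \<Rightarrow> real ^ ('m::finite + 'n::finite)" where
  "stack x1 x2 = (\<chi> i. case i of Inl a \<Rightarrow> x1 $ a | Inr b \<Rightarrow> x2 $ b)"

definition utility1 ::
  "real ^ 'n ^ 'm \<Rightarrow> real ^ 'm \<Rightarrow> real ^ 'n \<Rightarrow> real ^ 'm::finite \<Rightarrow> real ^ 'n::finite \<Rightarrow> real" where
  "utility1 A b1 b2 x1 x2 = x1 \<bullet> (A *v x2) + b1 \<bullet> x1 - b2 \<bullet> x2"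

text \<open>Player 2 has utility \<open>- utility1\<close>, hence minimises \<open>utility1\<close>.\<close>

definition nash_equilibrium ::
  "real ^ 'n ^ 'm \<Rightarrow> real ^ 'm \<Rightarrow> real ^ 'n \<Rightarrow> real ^ 'm::finite \<Rightarrow> real ^ 'n::finite \<Rightarrow> bool" where
  "nash_equilibrium A b1 b2 x1s x2s \<longleftrightarrow>
     (\<forall>x1 x2. utility1 A b1 b2 x1 x2s \<le> utility1 A b1 b2 x1s x2s \<and>
              utility1 A b1 b2 x1s x2s \<le> utility1 A b1 b2 x1s x2)"

definition game_matrix ::
  "real ^ 'n ^ 'm \<Rightarrow> real ^ ('m::finite + 'n::finite) ^ ('m + 'n)" where
  "game_matrix A = (\<chi> i j.
     case i of
       Inl a \<Rightarrow> (case j of Inl a' \<Rightarrow> 0 | Inr b \<Rightarrow> A $ a $ b)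
     | Inr b \<Rightarrow> (case j of Inl a \<Rightarrow> - (transpose A $ b $ a) | Inr b' \<Rightarrow> 0))"

text \<open>The vector field \<open>x \<mapsto> G x + c\<close> with \<open>c = (b\<^sub>1, b\<^sub>2)\<close>.\<close>

definition game_field ::
  "real ^ 'n ^ 'm \<Rightarrow> real ^ 'm \<Rightarrow> real ^ 'n \<Rightarrow>
   real ^ ('m::finite + 'n::finite) \<Rightarrow> real ^ ('m + 'n)" where
  "game_field A b1 b2 x = game_matrix A *v x + stack b1 b2"

definition is_imgd ::
  "real ^ 'n ^ 'm \<Rightarrow> real ^ 'm \<Rightarrow> real ^ 'n \<Rightarrow> real \<Rightarrow>
   (nat \<Rightarrow> real ^ ('m::finite + 'n::finite)) \<Rightarrow> bool" where
  "is_imgd A b1 b2 \<eta> x \<longleftrightarrow>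
     (\<forall>t. x (Suc t) =
        x t + (\<eta> / 2) *\<^sub>R (game_field A b1 b2 (x (Suc t)) + game_field A b1 b2 (x t)))"

definition time_average :: "(nat \<Rightarrow> 'a::real_vector) \<Rightarrow> nat \<Rightarrow> 'a" where
  "time_average x T = (1 / real T) *\<^sub>R (\<Sum>t<T. x t)"

lemma game_matrix_skew: "transpose (game_matrix A) = - game_matrix A"
  by (auto simp: vec_eq_iff transpose_def game_matrix_def split: sum.splits)

lemma inner_game_matrix_self: "x \<bullet> (game_matrix A *v x) = 0"
proof -
  have "x \<bullet> (game_matrix A *v x) = (transpose (game_matrix A) *v x) \<bullet> x"
    by (simp add: dot_lmul_matrix)
  also have "\<dots> = - (x \<bullet> (game_matrix A *v x))"
    by (simp add: game_matrix_skew inner_commute matrix_vector_mult_def vec_eq_iff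
        sum_negf inner_vec_def)
  finally show ?thesis by simp
qed

lemma invertible_imgd_matrix: "invertible (mat 1 - (\<eta> / 2) *\<^sub>R game_matrix A)"
proof -
  have "x = 0" if "(mat 1 - (\<eta> / 2) *\<^sub>R game_matrix A) *v x = 0" for x
  proof -
    have "x = (\<eta> / 2) *\<^sub>R (game_matrix A *v x)"
      using that by (simp add: matrix_vector_mult_diff_rdistrib scaleR_matrix_vector_assoc)
    then have "x \<bullet> x = (\<eta> / 2) * (x \<bullet> (game_matrix A *v x))"
      by (metis inner_scaleR_right)
    then show ?thesis by (simp add: inner_game_matrix_self)
  qed
  then show ?thesis
    by (metis matrix_left_invertible_ker invertible_left_inverse)
qed

text \<open>The implicit recursion is the explicit one, so trajectories exist and are unique.\<close>

lemma is_imgd_explicit: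
  "is_imgd A b1 b2 \<eta> x \<longleftrightarrow>
     (\<forall>t. x (Suc t) = matrix_inv (mat 1 - (\<eta> / 2) *\<^sub>R game_matrix A) *v
        ((mat 1 + (\<eta> / 2) *\<^sub>R game_matrix A) *v x t + \<eta> *\<^sub>R stack b1 b2))"
proof -
  let ?M = "mat 1 - (\<eta> / 2) *\<^sub>R game_matrix A"
  have M_inv: "?M ** matrix_inv ?M = mat 1 \<and> matrix_inv ?M ** ?M = mat 1"
    using invertible_imgd_matrix[of \<eta> A] unfolding invertible_def matrix_inv_def
    by (rule someI_ex)
  have inv: "v = matrix_inv ?M *v w \<longleftrightarrow> ?M *v v = w" for v w
  proof
    show "?M *v v = w" if "v = matrix_inv ?M *v w"
      unfolding that matrix_vector_mul_assoc using M_inv by simp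
    show "v = matrix_inv ?M *v w" if "?M *v v = w"
      unfolding that[symmetric] matrix_vector_mul_assoc using M_inv by simp
  qed
  have "v = u + (\<eta> / 2) *\<^sub>R (game_field A b1 b2 v + game_field A b1 b2 u) \<longleftrightarrow>
      ?M *v v = (mat 1 + (\<eta> / 2) *\<^sub>R game_matrix A) *v u + \<eta> *\<^sub>R stack b1 b2" for u v
  proof -
    define h where "h = \<eta> / 2"
    define c where "c = stack b1 b2"
    have eta: "\<eta> *\<^sub>R c = h *\<^sub>R c + h *\<^sub>R c"
      by (simp add: h_def flip: scaleR_add_left)
    have M: "(mat 1 - h *\<^sub>R game_matrix A) *v v = v - h *\<^sub>R (game_matrix A *v v)"
      by (simp add: matrix_vector_mult_diff_rdistrib scaleR_matrix_vector_assoc)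
    have P: "(mat 1 + h *\<^sub>R game_matrix A) *v u = u + h *\<^sub>R (game_matrix A *v u)"
      by (simp add: matrix_vector_mult_add_rdistrib scaleR_matrix_vector_assoc)
    show ?thesis
      unfolding h_def[symmetric] M P game_field_def c_def[symmetric] eta scaleR_add_right
        diff_eq_eq
      by (simp only: ac_simps)
  qed
  then show ?thesis by (simp add: is_imgd_def inv)
qed

lemma ex1_imgd: "\<exists>!x. is_imgd A b1 b2 \<eta> x \<and> x 0 = x0"
proof -
  define step where "step = (\<lambda>u. matrix_inv (mat 1 - (\<eta> / 2) *\<^sub>R game_matrix A) *v
        ((mat 1 + (\<eta> / 2) *\<^sub>R game_matrix A) *v u + \<eta> *\<^sub>R stack b1 b2))"
  have imgd: "is_imgd A b1 b2 \<eta> x \<longleftrightarrow> (\<forall>t. x (Suc t) = step (x t))" for x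
    by (simp add: is_imgd_explicit step_def)
  show ?thesis
  proof (rule ex1I[of _ "\<lambda>t. (step ^^ t) x0"])
    fix x assume "is_imgd A b1 b2 \<eta> x \<and> x 0 = x0"
    then have "x t = (step ^^ t) x0" for t
      by (induction t) (auto simp: imgd)
    then show "x = (\<lambda>t. (step ^^ t) x0)" by auto
  qed (simp add: imgd)
qed

end

theory Submission
  imports Defs
begin

text \<open>
  Put \<open>e t = x t - x*\<close>, so that \<open>G (x t) + c = G (e t)\<close> at a Nash equilibrium \<open>x*\<close>. Pairing the
  midpoint rule with \<open>e (t + 1) + e t\<close> and using skew-symmetry of \<open>G\<close> shows that \<open>norm (e t)\<close> is
  constant. Summing the midpoint rule over \<open>t < T\<close> telescopes to
  \<open>T (G (avg T) + c) = (e T - e 0) / \<eta> - G (e T - e 0) / 2\<close>, and \<open>norm (e T - e 0) \<le> 2 norm (e 0)\<close>.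
\<close>

lemma sum_UNIV_sum:
  fixes f :: "'a::finite + 'b::finite \<Rightarrow> 'c::comm_monoid_add"
  shows "sum f UNIV = (\<Sum>a\<in>UNIV. f (Inl a)) + (\<Sum>b\<in>UNIV. f (Inr b))"
  by (simp add: sum.Plus flip: UNIV_Plus_UNIV)

lemma game_matrix_stack:
  "game_matrix A *v stack x1 x2 = stack (A *v x2) (- (transpose A *v x1))"
  by (auto simp: vec_eq_iff matrix_vector_mult_def game_matrix_def stack_def sum_UNIV_sum sum_negf
      split: sum.splits)

text \<open>The utility is affine in each player's own strategy, so moving along the own gradient
  changes it by exactly the squared norm of that gradient. Player 1 climbs along \<open>g1\<close>,
  player 2 descends along \<open>g2\<close>; at an equilibrium neither move helps, so both gradients
  vanish.\<close>

lemma game_field_nash_equilibrium: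
  assumes "nash_equilibrium A b1 b2 x1 x2"
  shows "game_field A b1 b2 (stack x1 x2) = 0"
proof -
  define g1 where "g1 = A *v x2 + b1"
  define g2 where "g2 = transpose A *v x1 - b2"
  have u1: "utility1 A b1 b2 (x1 + g1) x2 = utility1 A b1 b2 x1 x2 + g1 \<bullet> g1"
    by (simp add: utility1_def g1_def inner_add_left inner_add_right inner_commute)
  have "utility1 A b1 b2 x1 (x2 - g2) = utility1 A b1 b2 x1 x2 - (x1 \<bullet> (A *v g2) - b2 \<bullet> g2)"
    by (simp add: utility1_def matrix_vector_mult_diff_distrib inner_diff_right)
  also have "x1 \<bullet> (A *v g2) - b2 \<bullet> g2 = g2 \<bullet> g2"
    by (simp add: g2_def inner_diff_left dot_lmul_matrix)
  finally have u2: "utility1 A b1 b2 x1 (x2 - g2) = utility1 A b1 b2 x1 x2 - g2 \<bullet> g2" .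
  have "utility1 A b1 b2 (x1 + g1) x2 \<le> utility1 A b1 b2 x1 x2"
    and "utility1 A b1 b2 x1 x2 \<le> utility1 A b1 b2 x1 (x2 - g2)"
    using assms unfolding nash_equilibrium_def by blast+
  then have "g1 \<bullet> g1 = 0" and "g2 \<bullet> g2 = 0"
    using inner_ge_zero[of g1] inner_ge_zero[of g2] unfolding u1 u2 by linarith+
  then have "g1 = 0" and "g2 = 0"
    by (simp_all only: inner_eq_zero_iff)
  then show ?thesis
    \<comment> \<open>The two blocks of the field are \<open>g1\<close> and
      \<open>- g2\<close>.\<close>
    unfolding game_field_def game_matrix_stack
    by (auto simp: stack_def vec_eq_iff g1_def g2_def split: sum.splits)
qed

lemma game_field_eq_diff:
  assumes "game_field A b1 b2 z = 0"
  shows "game_field A b1 b2 y = game_matrix A *v (y - z)"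
  using assms by (simp add: game_field_def matrix_vector_mult_diff_distrib add_eq_0_iff)

text \<open>Recentred at \<open>z\<close>, one step is the Cayley transform of a skew-symmetric
  matrix, hence an isometry.\<close>

lemma imgd_norm_diff_const:
  assumes "is_imgd A b1 b2 \<eta> x" and "game_field A b1 b2 z = 0"
  shows "norm (x t - z) = norm (x 0 - z)"
proof (induction t)
  case (Suc t)
  define u v where "u = x t - z" and "v = x (Suc t) - z"
  have "x (Suc t) = x t + (\<eta> / 2) *\<^sub>R (game_matrix A *v v + game_matrix A *v u)"
    using assms(1) unfolding is_imgd_def u_def v_def game_field_eq_diff[OF assms(2)] by blast
  then have step: "v - u = (\<eta> / 2) *\<^sub>R (game_matrix A *v (v + u))"
    unfolding matrix_vector_right_distrib by (simp add: u_def v_def diff_eq_eq add.commute)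
  have "v \<bullet> v - u \<bullet> u = (v + u) \<bullet> (v - u)"
    by (simp add: inner_diff_right inner_add_left inner_commute[of u v])
  also have "\<dots> = 0"
    by (simp only: step inner_scaleR_right inner_game_matrix_self mult_zero_right)
  finally have "norm v = norm u"
    by (simp add: norm_eq_sqrt_inner)
  with Suc.IH show ?case by (simp add: u_def v_def)
qed simp

text \<open>The midpoint rule sums the field with trapezoidal weights. Passing to the plain sum over
  \<open>t < T\<close> costs half the difference of the field at the two endpoints, in which the
  constant term cancels.\<close>

lemma imgd_sum_field:
  fixes A :: "real ^ 'n ^ 'm"
  assumes "is_imgd A b1 b2 \<eta> x"
  shows "x T - x 0 = \<eta> *\<^sub>R (\<Sum>t<T. game_field A b1 b2 (x t))
    + (\<eta> / 2) *\<^sub>R (game_matrix A *v (x T - x 0))"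
proof (induction T)
  case (Suc T)
  define F where "F = game_field A b1 b2"
  have F: "game_matrix A *v (y - w) = F y - F w" for y w
    by (simp add: F_def game_field_def matrix_vector_mult_diff_distrib)
  \<comment> \<open>One half weight of \<open>F (x T)\<close> comes from the induction hypothesis
    and one from the new step; together they give the new summand its full weight
    \<open>\<eta>\<close>.\<close>
  have half: "\<eta> *\<^sub>R y = (\<eta> / 2) *\<^sub>R y + (\<eta> / 2) *\<^sub>R y" for y :: "real ^ ('m + 'n)"
    by (simp flip: scaleR_add_left)
  have "x (Suc T) = x T + (\<eta> / 2) *\<^sub>R (F (x (Suc T)) + F (x T))"
    using assms by (simp add: is_imgd_def F_def)
  then have "x (Suc T) - x 0 = (x T - x 0) + (\<eta> / 2) *\<^sub>R (F (x (Suc T)) + F (x T))"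
    by (simp add: algebra_simps)
  also note Suc.IH
  finally show ?case
    unfolding F F_def[symmetric] sum.lessThan_Suc half
    by (simp add: scaleR_add_right scaleR_diff_right)
qed simp

text \<open>Affine maps commute with averages whose weights sum to 1. For \<open>T = 0\<close> the
  left side would be \<open>stack b1 b2\<close> and the right side 0.\<close>

lemma game_field_time_average:
  assumes "T > 0"
  shows "game_field A b1 b2 (time_average x T) = time_average (\<lambda>t. game_field A b1 b2 (x t)) T"
proof -
  have "(\<Sum>t<T. game_field A b1 b2 (x t)) =
      game_matrix A *v (\<Sum>t<T. x t) + real T *\<^sub>R stack b1 b2"
    unfolding game_field_def sum.distrib linear_sum[OF matrix_vector_mul_linear]
    by (simp only: sum_constant_scaleR card_lessThan)
  then have "time_average (\<lambda>t. game_field A b1 b2 (x t)) T =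
      (1 / real T) *\<^sub>R (game_matrix A *v (\<Sum>t<T. x t)) + stack b1 b2"
    using assms by (simp add: time_average_def scaleR_add_right)
  then show ?thesis
    by (simp add: game_field_def time_average_def matrix_vector_mult_scaleR)
qed

lemma imgd_average_bound:
  assumes imgd: "is_imgd A b1 b2 \<eta> x" and "\<eta> > 0" and z: "game_field A b1 b2 z = 0" and "T > 0"
  shows "norm (game_field A b1 b2 (time_average x T))
    \<le> norm (x 0 - z) / real T * (2 / \<eta> + onorm ((*v) (game_matrix A)))"
proof -
  define d where "d = x T - x 0"
  define K where "K = onorm ((*v) (game_matrix A))"
  define S where "S = (\<Sum>t<T. game_field A b1 b2 (x t))"
  \<comment> \<open>Both endpoints lie on one sphere around \<open>z\<close>, so \<open>d\<close> is
    at most its diameter. This factor 2 turns \<open>1 / \<eta> + K / 2\<close> into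
    \<open>2 / \<eta> + K\<close>.\<close>
  have d_le: "norm d \<le> 2 * norm (x 0 - z)"
  proof -
    have "norm d = norm ((x T - z) - (x 0 - z))" by (simp add: d_def)
    also have "\<dots> \<le> norm (x T - z) + norm (x 0 - z)" by (rule norm_triangle_ineq4)
    finally show ?thesis unfolding imgd_norm_diff_const[OF imgd z, of T] by simp
  qed
  have Gd: "norm (game_matrix A *v d) \<le> K * norm d"
    unfolding K_def by (intro onorm matrix_vector_mul_bounded_linear)
  have K: "K \<ge> 0"
    unfolding K_def by (intro onorm_pos_le matrix_vector_mul_bounded_linear)
  have "d = \<eta> *\<^sub>R S + (\<eta> / 2) *\<^sub>R (game_matrix A *v d)"
    using imgd_sum_field[OF imgd, of T] by (simp add: d_def S_def)
  then have "\<eta> *\<^sub>R S = d - (\<eta> / 2) *\<^sub>R (game_matrix A *v d)"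
    by (simp add: eq_diff_eq)
  then have "norm (\<eta> *\<^sub>R S) \<le> norm d + norm ((\<eta> / 2) *\<^sub>R (game_matrix A *v d))"
    by (simp only: norm_triangle_ineq4)
  then have "\<eta> * norm S \<le> norm d + \<eta> / 2 * norm (game_matrix A *v d)"
    using \<open>\<eta> > 0\<close> by simp
  also have "\<dots> \<le> norm d + \<eta> / 2 * (K * norm d)"
    using Gd \<open>\<eta> > 0\<close> by (intro add_left_mono mult_left_mono) auto
  also have "\<dots> = norm d * (1 + \<eta> / 2 * K)"
    by (simp add: algebra_simps)
  also have "\<dots> \<le> 2 * norm (x 0 - z) * (1 + \<eta> / 2 * K)"
    using d_le K \<open>\<eta> > 0\<close> by (intro mult_right_mono) auto
  also have "\<dots> = \<eta> * (norm (x 0 - z) * (2 / \<eta> + K))"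
    using \<open>\<eta> > 0\<close> by (simp add: field_simps)
  finally have "norm S \<le> norm (x 0 - z) * (2 / \<eta> + K)"
    using \<open>\<eta> > 0\<close> by simp
  then have "norm S / real T \<le> norm (x 0 - z) * (2 / \<eta> + K) / real T"
    by (intro divide_right_mono) auto
  then show ?thesis
    unfolding game_field_time_average[OF \<open>T > 0\<close>]
    by (simp add: time_average_def S_def K_def)
qed

theorem theorem2:
  fixes A :: "real ^ 'n ^ 'm"
    and b1 x1s :: "real ^ 'm"
    and b2 x2s :: "real ^ 'n"
    and x0 :: "real ^ ('m + 'n)"
  assumes "nash_equilibrium A b1 b2 x1s x2s"
  shows "(\<forall>\<eta> x. \<eta> > 0 \<longrightarrow> is_imgd A b1 b2 \<eta> x \<longrightarrow> x 0 = x0 \<longrightarrow>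
           (\<forall>T\<ge>1. norm (game_field A b1 b2 (time_average x T))
              \<le> norm (x0 - stack x1s x2s) / real T * (2 / \<eta> + onorm ((*v) (game_matrix A))))) \<and>
         (\<forall>x. (\<forall>\<eta>>0. is_imgd A b1 b2 \<eta> (x \<eta>) \<and> x \<eta> 0 = x0) \<longrightarrow>
           (\<lambda>(\<eta>, T). norm (game_field A b1 b2 (time_average (x \<eta>) T)))
             \<in> O[principal ({0<..} \<times> {1..})](\<lambda>(\<eta>, T). 1 / (\<eta> * real T) + 1 / real T))"
proof (intro conjI allI impI)
  have z: "game_field A b1 b2 (stack x1s x2s) = 0"
    using assms by (rule game_field_nash_equilibrium)
  show bound: "norm (game_field A b1 b2 (time_average x T))
      \<le> norm (x0 - stack x1s x2s) / real T * (2 / \<eta> + onorm ((*v) (game_matrix A)))"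
    if "\<eta> > 0" "is_imgd A b1 b2 \<eta> x" "x 0 = x0" "1 \<le> T" for \<eta> x T
    using imgd_average_bound[OF that(2,1) z, of T] that by simp
  fix x :: "real \<Rightarrow> nat \<Rightarrow> real ^ ('m + 'n)"
  assume x: "\<forall>\<eta>>0. is_imgd A b1 b2 \<eta> (x \<eta>) \<and> x \<eta> 0 = x0"
  define D where "D = norm (x0 - stack x1s x2s)"
  define K where "K = onorm ((*v) (game_matrix A))"
  have K: "K \<ge> 0"
    unfolding K_def by (intro onorm_pos_le matrix_vector_mul_bounded_linear)
  have "norm (game_field A b1 b2 (time_average (x \<eta>) T))
      \<le> D * (2 + K) * (1 / (\<eta> * real T) + 1 / real T)" if "\<eta> > 0" "T \<ge> 1" for \<eta> T
  proof -
    have "norm (game_field A b1 b2 (time_average (x \<eta>) T)) \<le> D / real T * (2 / \<eta> + K)"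
      unfolding D_def K_def using that x by (intro bound) auto
    \<comment> \<open>Expanding the product gives \<open>2 / \<eta> + K\<close> plus the nonnegative
      terms \<open>K / \<eta>\<close> and 2.\<close>
    also have "\<dots> \<le> D / real T * ((2 + K) * (1 / \<eta> + 1))"
      using that K by (intro mult_left_mono) (auto simp: D_def field_simps)
    also have "\<dots> = D * (2 + K) * (1 / (\<eta> * real T) + 1 / real T)"
      using that by (simp add: field_simps)
    finally show ?thesis .
  qed
  then show "(\<lambda>(\<eta>, T). norm (game_field A b1 b2 (time_average (x \<eta>) T)))
      \<in> O[principal ({0<..} \<times> {1..})](\<lambda>(\<eta>, T). 1 / (\<eta> * real T) + 1 / real T)"
    \<comment> \<open>For a principal filter, eventually means everywhere on the set, so the
      constant has to serve all \<open>\<eta> > 0\<close> and \<open>T \<ge> 1\<close> at once;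
      \<open>D * (2 + K)\<close> depends on neither.\<close>
    by (intro bigoI[where c = "D * (2 + K)"]) (auto simp: eventually_principal)
qed

end
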